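(* Let $\mathbb P,\mathbb X,\mathbb Y$ be real Banach spaces, let $C$ be a closed convex cone with $\{\mathbf 0\}\subsetneqq C\subsetneqq\mathbb Y$, let $\varphi:\mathbb P\times\mathbb X\to\mathbb R$, and let $F:\mathbb P\times\mathbb X\rightrightarrows\mathbb Y$ be a set-valued mapping with nonempty closed values. For $p\in\mathbb P$ put $\mathsf R(p)=\{x\in\mathbb X\mid F(p,x)\subseteq C\}$ and $\mathsf{val}(p)=\inf_{x\in\mathsf R(p)}\varphi(p,x)\in\mathbb R\cup\{\pm\infty\}$. Suppose that: (i) $\varphi$ is convex and continuous on $\mathbb P\times\mathbb X$; (ii) for every $p\in\mathbb P$ there exists $\hat x_p\in\mathbb X$ such that $F(p,\hat x_p)$ is $C$-bounded; (iii) for every $p\in\mathbb P$, $F(p,\cdot):\mathbb X\rightrightarrows\mathbb Y$ is lower semicontinuous on $\mathbb X$; (iv) $F:\mathbb P\times\mathbb X\rightrightarrows\mathbb Y$ is $C$-concave; (v) for every $x\in\mathbb X$, $F(\cdot,x):\mathbb P\rightrightarrows\mathbb Y$ is Hausdorff $C$-upper semicontinuous on $\mathbb P$; (vi) $\alpha_F>1$, where $\alpha_F=\inf\{\mathrm{inc}(F(p,\cdot);x)\mid (p,x)\in\mathbb P\times\mathbb X,\ F(p,x)\not\subseteq C\}$. Then either $\mathsf{val}\equiv-\infty$ on $\mathbb P$, or $\mathrm{dom}\,\mathsf{val}=\mathbb P$ and $\mathsf{val}$ is locally Lipschitz around each point $p\in\mathbb P$.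
   Context: Conventions: $\inf\varnothing=+\infty$; $\mathrm{dom}\,\mathsf{val}$ is the set of points where $\mathsf{val}$ is finite. For a nonempty set $S$ in a normed space and $r\ge0$, $\mathrm B[S;r]=\{y\mid \mathrm{dist}(y;S)\le r\}$, where $\mathrm{dist}(y;S)=\inf_{s\in S}\|y-s\|$; for a point $x$, $\mathrm B[x;r]$ is the closed ball. A set $S\subseteq\mathbb Y$ is $C$-bounded if $S\setminus C$ is norm-bounded. A set-valued mapping $G$ is $C$-concave if $G(tv_1+(1-t)v_2)\subseteq tG(v_1)+(1-t)G(v_2)+C$ for all $v_1,v_2$ in its domain space and $t\in[0,1]$. A set-valued mapping $G:\mathbb P\rightrightarrows\mathbb Y$ is Hausdorff $C$-upper semicontinuous at $p_0$ if for every $\varepsilon>0$ there is $\delta>0$ such that $G(p)\subseteq \mathrm B[G(p_0)+C;\varepsilon]$ for all $p\in\mathrm B[p_0;\delta]$; it is so on $\mathbb P$ if it is so at every point. Metric $C$-increase: $G:\mathbb X\rightrightarrows\mathbb Y$ is metrically $C$-increasing at $x_0\in\mathbb X$ if there exist $\alpha>1$ and $\delta>0$ such that $$(\ast)\qquad \forall r\in(0,\delta]\ \exists u\in\mathrm B[x_0;r]:\ \mathrm B[G(u);\alpha r]\subseteq\mathrm B[G(x_0)+C;r].$$ The exact bound of $C$-increase is $\mathrm{inc}(G;x_0)=\sup\{\alpha>1\mid \exists\delta>0 \text{ for which } (\ast) \text{ holds}\}$, with $\sup\varnothing=-\infty$ (so that $\alpha_F>1$ forces metric $C$-increase at all the points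 involved). *)

theory Defs
  imports "HOL-Analysis.Analysis"
begin

text \<open>The guard encodes \<open>dist(y; \<emptyset>) = +\<infinity>\<close>; the library has \<open>infdist y {} = 0\<close>.\<close>
definition enlargement :: "'a::real_normed_vector set \<Rightarrow> real \<Rightarrow> 'a set" where
  "enlargement S r = {y. S \<noteq> {} \<and> infdist y S \<le> r}"

definition cone_bounded :: "'a::real_normed_vector set \<Rightarrow> 'a set \<Rightarrow> bool" where
  "cone_bounded C S \<longleftrightarrow> bounded (S - C)"

text \<open>Sums of sets are Minkowski sums.\<close>
definition cone_concave ::
  "'b::real_normed_vector set \<Rightarrow> ('a::real_normed_vector \<Rightarrow> 'b set) \<Rightarrow> bool" where
  "cone_concave C G \<longleftrightarrow>
     (\<forall>v1 v2. \<forall>t\<in>{0..1}.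
        G (t *\<^sub>R v1 + (1 - t) *\<^sub>R v2)
          \<subseteq> (\<lambda>y. t *\<^sub>R y) ` G v1 + (\<lambda>y. (1 - t) *\<^sub>R y) ` G v2 + C)"

definition hausdorff_cone_usc_at ::
  "'b::real_normed_vector set \<Rightarrow> ('a::real_normed_vector \<Rightarrow> 'b set) \<Rightarrow> 'a \<Rightarrow> bool" where
  "hausdorff_cone_usc_at C G p0 \<longleftrightarrow>
     (\<forall>\<epsilon>>0. \<exists>\<delta>>0. \<forall>p\<in>cball p0 \<delta>. G p \<subseteq> enlargement (G p0 + C) \<epsilon>)"

definition set_valued_lsc_at ::
  "('a::topological_space \<Rightarrow> 'b::topological_space set) \<Rightarrow> 'a \<Rightarrow> bool" where
  "set_valued_lsc_at G x0 \<longleftrightarrow>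
     (\<forall>V. open V \<and> G x0 \<inter> V \<noteq> {} \<longrightarrow> (\<forall>\<^sub>F x in nhds x0. G x \<inter> V \<noteq> {}))"

definition increases_with_constant ::
  "'b::real_normed_vector set \<Rightarrow> ('a::real_normed_vector \<Rightarrow> 'b set) \<Rightarrow> 'a \<Rightarrow> real \<Rightarrow> bool" where
  "increases_with_constant C G x0 \<alpha> \<longleftrightarrow>
     (\<exists>\<delta>>0. \<forall>r\<in>{0<..\<delta>}. \<exists>u\<in>cball x0 r.
        enlargement (G u) (\<alpha> * r) \<subseteq> enlargement (G x0 + C) r)"

text \<open>In \<^typ>\<open>ereal\<close>, \<open>Sup {} = -\<infinity>\<close> and \<open>Inf {} = \<infinity>\<close>, so a point at which \<open>G\<close> is not
  metrically \<open>C\<close>-increasing has bound \<open>-\<infinity>\<close>.\<close>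
definition inc_bound ::
  "'b::real_normed_vector set \<Rightarrow> ('a::real_normed_vector \<Rightarrow> 'b set) \<Rightarrow> 'a \<Rightarrow> ereal" where
  "inc_bound C G x0 = Sup (ereal ` {\<alpha>. \<alpha> > 1 \<and> increases_with_constant C G x0 \<alpha>})"

definition uniform_inc_bound ::
  "'y::real_normed_vector set \<Rightarrow>
   ('p::real_normed_vector \<times> 'x::real_normed_vector \<Rightarrow> 'y set) \<Rightarrow> ereal" where
  "uniform_inc_bound C F =
     Inf {inc_bound C (\<lambda>x'. F (p, x')) x | p x. \<not> F (p, x) \<subseteq> C}"

definition feasible :: "'y set \<Rightarrow> ('p \<times> 'x \<Rightarrow> 'y set) \<Rightarrow> 'p \<Rightarrow> 'x set" where
  "feasible C F p = {x. F (p, x) \<subseteq> C}"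

definition val :: "'y set \<Rightarrow> ('p \<times> 'x \<Rightarrow> 'y set) \<Rightarrow> ('p \<times> 'x \<Rightarrow> real) \<Rightarrow> 'p \<Rightarrow> ereal" where
  "val C F \<phi> p = (INF x\<in>feasible C F p. ereal (\<phi> (p, x)))"

definition finite_dom :: "('a \<Rightarrow> ereal) \<Rightarrow> 'a set" where
  "finite_dom f = {p. \<bar>f p\<bar> \<noteq> \<infinity>}"

text \<open>Finiteness near \<open>p\<close> is part of the notion, since \<^const>\<open>real_of_ereal\<close> sends
  \<open>\<plusminus>\<infinity>\<close> to \<open>0\<close>.\<close>
definition locally_lipschitz_around :: "('a::real_normed_vector \<Rightarrow> ereal) \<Rightarrow> 'a \<Rightarrow> bool" where
  "locally_lipschitz_around f p \<longleftrightarrow>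
     (\<exists>r>0. \<exists>L. cball p r \<subseteq> finite_dom f \<and> lipschitz_on L (cball p r) (\<lambda>q. real_of_ereal (f q)))"

end

theory Submission
  imports Defs
begin

text \<open>
  Write \<open>R p\<close> for the feasible set at \<open>p\<close> and let
  \<open>f\<^sub>p x = sup {dist (y, C) | y \<in> F (p, x)}\<close> be the excess of \<open>F (p, x)\<close> over \<open>C\<close>, so that
  \<open>x \<in> R p\<close> iff \<open>f\<^sub>p x = 0\<close>.  The theorem follows from two facts: \<open>val\<close> is convex, and it is
  locally bounded above.  A convex function below \<open>+\<infinity>\<close> that is \<open>-\<infinity>\<close> at one point is \<open>-\<infinity>\<close>
  everywhere, and a finite convex function that is bounded above near a point is Lipschitz near it.

  Convexity: \<open>C\<close>-concavity of \<open>F\<close> makes the graph of \<open>R\<close> convex, and \<open>val\<close> is the partial infimum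
  over this graph of the jointly convex function \<open>\<phi>\<close>.

  Local upper bound: here metric \<open>C\<close>-increase enters, through an error bound.  Let
  \<open>1 < \<alpha> < \<alpha>\<^sub>F\<close>.  At an infeasible point \<open>x\<close>, metric increase yields a nearby \<open>u\<close> such that the
  \<open>\<alpha>r\<close>-neighbourhood of \<open>F (p, u)\<close> lies in the \<open>r\<close>-neighbourhood of \<open>F (p, x) + C\<close>.  As \<open>C\<close> is
  convex, points outside \<open>C\<close> can be moved straight away from \<open>C\<close>, so the inclusion forces
  \<open>f\<^sub>p u \<le> f\<^sub>p x - (\<alpha> - 1) r\<close> (lemma \<open>excess_decrease\<close>).  Ekeland's variational principle turns this
  infinitesimal decrease into a global estimate: from \<open>x\<^sub>0\<close> there is a feasible point within
  distance \<open>f\<^sub>p x\<^sub>0 / (\<alpha> - 1)\<close> (lemma \<open>error_bound\<close>).  Started at a point where \<open>F (p, x\<^sub>0)\<close> is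
  \<open>C\<close>-bounded, it gives \<open>R p \<noteq> {}\<close>, that is \<open>val p < +\<infinity>\<close>.  Started at \<open>x \<in> R p\<close> for a parameter
  \<open>q\<close> near \<open>p\<close>, where upper semicontinuity makes \<open>f\<^sub>q x\<close> small, it gives points of \<open>R q\<close> close to
  \<open>x\<close>.  That they are close, and not just bounded, is what matters: a continuous \<open>\<phi>\<close> need not be
  bounded on bounded sets in infinite dimension, but it is bounded near \<open>(p, x)\<close>.
\<close>

section \<open>Ekeland's variational principle\<close>

text \<open>
  Each set \<open>S x\<close> of points that are below \<open>x\<close> by slope at least \<open>k\<close> is closed, and \<open>u \<in> S x\<close>
  implies \<open>S u \<subseteq> S x\<close>.  Moving repeatedly to an almost minimizer of \<open>f\<close> on the current set shrinks
  the diameters of these sets to \<open>0\<close>; their common point is the desired one.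
\<close>
lemma ekeland_principle:
  fixes f :: "'a::complete_space \<Rightarrow> real"
  assumes nonneg: "\<And>x. 0 \<le> f x" and k: "0 < k"
    and lsc: "\<And>t. closed {x. f x \<le> t}"
  obtains a where "f a + k * dist x0 a \<le> f x0"
    and "\<And>u. f u + k * dist a u \<le> f a \<Longrightarrow> u = a"
proof -
  define S where "S x = {u. f u + k * dist x u \<le> f x}" for x
  have S_refl: "x \<in> S x" for x
    by (simp add: S_def)
  have S_trans: "S u \<subseteq> S x" if "u \<in> S x" for u x
  proof
    fix v assume "v \<in> S u"
    moreover have "k * dist x v \<le> k * (dist x u + dist u v)"
      using k by (intro mult_left_mono dist_triangle) auto
    ultimately show "v \<in> S x"
      using that by (simp add: S_def distrib_left)
  qed
  have S_closed: "closed (S x)" for x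
  proof -
    have "S x = (\<Inter>t. {u. f u \<le> t} \<union> {u. t \<le> f x - k * dist x u})"
    proof (intro set_eqI iffI)
      fix u assume "u \<in> S x"
      then show "u \<in> (\<Inter>t. {u. f u \<le> t} \<union> {u. t \<le> f x - k * dist x u})"
        by (auto simp: S_def)
    next
      fix u assume u: "u \<in> (\<Inter>t. {u. f u \<le> t} \<union> {u. t \<le> f x - k * dist x u})"
      show "u \<in> S x"
      proof (rule ccontr)
        assume "u \<notin> S x"
        then have "f x - k * dist x u < f u"
          by (simp add: S_def)
        then obtain t where "f x - k * dist x u < t" "t < f u"
          using dense by blast
        moreover have "f u \<le> t \<or> t \<le> f x - k * dist x u"
          using u by blast
        ultimately show False
          by linarith
      qed
    qed
    moreover have "closed {u. t \<le> f x - k * dist x u}" for t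
      by (intro closed_Collect_le continuous_intros)
    ultimately show ?thesis
      using lsc by (simp add: closed_INT closed_Un)
  qed
  have almost_min: "\<exists>v\<in>S x. \<forall>u\<in>S x. f v \<le> f u + (1/2)^n" for x and n :: nat
  proof -
    have bdd: "bdd_below (f ` S x)"
      using nonneg by (auto intro!: bdd_belowI[of _ 0])
    have "Inf (f ` S x) < Inf (f ` S x) + (1/2)^n"
      by simp
    then obtain v where v: "v \<in> S x" "f v < Inf (f ` S x) + (1/2)^n"
      using cInf_lessD[of "f ` S x"] S_refl by blast
    have "f v \<le> f u + (1/2)^n" if "u \<in> S x" for u
      using cInf_lower[OF imageI[OF that] bdd] v by linarith
    with v show ?thesis
      by blast
  qed
  define step where "step n x = (SOME v. v \<in> S x \<and> (\<forall>u\<in>S x. f v \<le> f u + (1/2)^n))" for n x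
  have "step n x \<in> S x \<and> (\<forall>u\<in>S x. f (step n x) \<le> f u + (1/2)^n)" for x n
    unfolding step_def by (rule someI_ex) (use almost_min in blast)
  then have step: "\<And>x n. step n x \<in> S x"
    "\<And>x n u. u \<in> S x \<Longrightarrow> f (step n x) \<le> f u + (1/2)^n"
    by blast+
  define X where "X = rec_nat x0 step"
  have X0: "X 0 = x0" and X_Suc: "X (Suc n) = step n (X n)" for n
    by (simp_all add: X_def)
  have decr: "S (X n) \<subseteq> S (X m)" if "m \<le> n" for m n
    using that by (induction rule: dec_induct) (use S_trans step(1) X_Suc in \<open>auto, blast\<close>)
  have radius: "k * dist (X (Suc n)) u \<le> (1/2)^n" if "u \<in> S (X (Suc n))" for n u
  proof -
    have "u \<in> S (X n)"
      using that decr[of n "Suc n"] by auto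
    then show ?thesis
      using step(2)[of u "X n" n] that by (simp add: S_def X_Suc)
  qed
  have small: "\<exists>n. \<forall>x\<in>S (X n). \<forall>y\<in>S (X n). dist x y < e" if "e > 0" for e
  proof -
    have "0 < k * e / 2"
      using k that by simp
    then obtain n where n: "(1/2)^n < k * e / 2"
      using real_arch_pow_inv[of "k * e / 2" "1/2"] by auto
    have "dist x y < e" if "x \<in> S (X (Suc n))" "y \<in> S (X (Suc n))" for x y
    proof -
      have "k * dist x y \<le> k * (dist (X (Suc n)) x + dist (X (Suc n)) y)"
        using k by (intro mult_left_mono dist_triangle3) auto
      also have "\<dots> < k * e"
        using radius[OF that(1)] radius[OF that(2)] n by (simp add: distrib_left)
      finally show ?thesis
        using k by simp
    qed
    then show ?thesis
      by blast
  qed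
  obtain a where a: "\<And>n. a \<in> S (X n)"
    using decreasing_closed_nest[of "\<lambda>n. S (X n)"] S_closed S_refl decr small by blast
  show thesis
  proof (rule that)
    show "f a + k * dist x0 a \<le> f x0"
      using a[of 0] by (simp add: X0 S_def)
    fix u assume "f u + k * dist a u \<le> f a"
    then have "u \<in> S (X n)" for n
      using S_trans[OF a] by (auto simp: S_def)
    then have "dist u a < e" if "e > 0" for e
      using small[OF that] a by blast
    then show "u = a"
      by (metis dist_eq_0_iff less_irrefl zero_less_dist_iff)
  qed
qed

section \<open>Metric increase and the distance to the feasible set\<close>

lemma infdist_le_add_of_enlargement:
  assumes "y \<in> enlargement S r" and "\<And>s. s \<in> S \<Longrightarrow> infdist s C \<le> m"
  shows "infdist y C \<le> m + r"
proof -
  have S: "S \<noteq> {}" "infdist y S \<le> r"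
    using assms(1) by (auto simp: enlargement_def)
  have "infdist y C - m \<le> (INF s\<in>S. dist y s)"
  proof (rule cINF_greatest[OF S(1)])
    fix s assume "s \<in> S"
    then show "infdist y C - m \<le> dist y s"
      using infdist_triangle[of y C s] assms(2)[of s] by linarith
  qed
  then show ?thesis
    using S by (simp add: infdist_notempty)
qed

lemma convex_cone_add_closed:
  assumes "convex C" and "cone C" and "x \<in> C" and "y \<in> C"
  shows "x + y \<in> C"
  using assms convex_cone[of C] by blast

lemma infdist_add_cone_le:
  fixes C :: "'a::real_normed_vector set"
  assumes "convex C" and "cone C" and "c \<in> C"
  shows "infdist (y + c) C \<le> infdist y C"
proof -
  have "infdist (y + c) C \<le> (INF d\<in>C. dist y d)"
  proof (rule cINF_greatest)
    fix d assume "d \<in> C"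
    then have "d + c \<in> C"
      using assms convex_cone_add_closed by blast
    then have "infdist (y + c) C \<le> dist (y + c) (d + c)"
      by (rule infdist_le)
    then show "infdist (y + c) C \<le> dist y d"
      by (simp add: dist_norm)
  qed (use assms in auto)
  moreover have "C \<noteq> {}"
    using assms by auto
  ultimately show ?thesis
    by (simp add: infdist_notempty)
qed

text \<open>
  Moving from \<open>y\<close> along the ray that starts at a point \<open>c \<in> C\<close> increases the distance to \<open>C\<close> at
  least linearly, because this distance is convex and vanishes at \<open>c\<close>.  When \<open>c\<close> is an almost nearest
  point the gain is almost the length of the move.  No nearest point needs to exist.
\<close>
lemma infdist_add_radius_le:
  fixes C :: "'a::real_normed_vector set"
  assumes C: "convex C" "C \<noteq> {}" and pos: "0 < infdist y C" and s: "0 < s"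
    and ball: "\<And>z. dist y z \<le> s \<Longrightarrow> infdist z C \<le> m"
  shows "infdist y C + s \<le> m"
proof -
  define d where "d = infdist y C"
  have key: "d * s \<le> dist y c * (m - d)" if c: "c \<in> C" for c
  proof -
    define D where "D = dist y c"
    have D: "D > 0" "d \<le> D"
      using pos infdist_le[OF c, of y] by (auto simp: D_def d_def)
    define l where "l = D / (D + s)"
    have l: "0 < l" "l < 1" "l * (D + s) = D"
      using D s by (auto simp: l_def)
    define z where "z = y + (s / D) *\<^sub>R (y - c)"
    have "dist y z = s"
      using D s by (simp add: z_def dist_norm D_def)
    then have zm: "infdist z C \<le> m"
      using ball by simp
    have "l + l * (s / D) = l * (D + s) / D"
      using D by (simp add: field_simps)
    then have lsD: "l + l * (s / D) = 1"
      using l D by simp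
    have y_eq: "y = l *\<^sub>R z + (1 - l) *\<^sub>R c"
    proof -
      have "l *\<^sub>R z + (1 - l) *\<^sub>R c = (l + l * (s / D)) *\<^sub>R y + (1 - (l + l * (s / D))) *\<^sub>R c"
        by (simp add: z_def algebra_simps)
      then show ?thesis
        by (simp only: lsD) simp
    qed
    have "d / l \<le> (INF c'\<in>C. dist z c')"
    proof (rule cINF_greatest[OF C(2)])
      fix c' assume "c' \<in> C"
      then have "l *\<^sub>R c' + (1 - l) *\<^sub>R c \<in> C"
        using C c l by (intro convexD) auto
      then have "d \<le> dist y (l *\<^sub>R c' + (1 - l) *\<^sub>R c)"
        unfolding d_def by (rule infdist_le)
      also have "y - (l *\<^sub>R c' + (1 - l) *\<^sub>R c) = l *\<^sub>R (z - c')"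
        by (subst y_eq) (simp add: algebra_simps)
      then have "dist y (l *\<^sub>R c' + (1 - l) *\<^sub>R c) = l * dist z c'"
        using l by (simp add: dist_norm)
      finally show "d / l \<le> dist z c'"
        using l by (simp add: field_simps)
    qed
    then have "d / l \<le> m"
      using zm C by (simp add: infdist_notempty)
    then have "d * (D + s) \<le> D * m"
      using D s by (simp add: l_def field_simps)
    then show ?thesis
      by (simp add: D_def algebra_simps)
  qed
  have d: "0 < d"
    using pos by (simp add: d_def)
  have m: "0 < m - d"
  proof -
    obtain c where "c \<in> C"
      using C by auto
    then have "0 < dist y c * (m - d)"
      using key[of c] d s by (meson less_le_trans mult_pos_pos)
    then show ?thesis
      by (simp add: zero_less_mult_iff)
  qed
  have "d * s / (m - d) \<le> (INF c\<in>C. dist y c)"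
    using key m C by (intro cINF_greatest) (auto simp: field_simps)
  then have "d * s / (m - d) \<le> d"
    using C by (simp add: d_def infdist_notempty)
  then have "d * s \<le> d * (m - d)"
    using m by (simp add: field_simps)
  then show ?thesis
    using d by (simp add: d_def)
qed

lemma increases_with_constant_mono:
  assumes "increases_with_constant C G x \<beta>" and "\<alpha> \<le> \<beta>"
  shows "increases_with_constant C G x \<alpha>"
proof -
  have "enlargement S (\<alpha> * r) \<subseteq> enlargement S (\<beta> * r)" if "r > 0" for S :: "'a set" and r
  proof -
    have "\<alpha> * r \<le> \<beta> * r"
      using that assms(2) by simp
    then show ?thesis
      by (auto simp: enlargement_def)
  qed
  then show ?thesis
    using assms(1) unfolding increases_with_constant_def
    by (meson greaterThanAtMost_iff order_trans)
qed

text \<open>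
  The neighbourhood of \<open>G x + C\<close> in the definition of metric increase has excess at most \<open>m + r\<close>
  over \<open>C\<close>.  It contains the \<open>\<alpha> r\<close>-neighbourhood of \<open>G u\<close>, whose excess is \<open>\<alpha> r\<close> more than that
  of \<open>G u\<close> unless \<open>G u \<subseteq> C\<close>.
\<close>
lemma excess_decrease:
  fixes C :: "'y::real_normed_vector set" and G :: "'x::real_normed_vector \<Rightarrow> 'y set"
  assumes C: "convex C" "cone C" "C \<noteq> {}" and \<alpha>: "1 < \<alpha>"
    and inc: "increases_with_constant C G x \<alpha>"
    and m: "0 < m" "\<And>y. y \<in> G x \<Longrightarrow> infdist y C \<le> m"
  obtains u r where "0 < r" and "dist x u \<le> r"
    and "\<And>y. y \<in> G u \<Longrightarrow> infdist y C \<le> m - (\<alpha> - 1) * r"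
proof -
  obtain \<delta> where \<delta>: "\<delta> > 0" "\<And>r. 0 < r \<Longrightarrow> r \<le> \<delta> \<Longrightarrow>
      \<exists>u\<in>cball x r. enlargement (G u) (\<alpha> * r) \<subseteq> enlargement (G x + C) r"
    using inc by (auto simp: increases_with_constant_def)
  \<comment> \<open>The second bound keeps \<open>m - (\<alpha> - 1) * r\<close> nonnegative, which covers the points of \<open>G u \<inter> C\<close>.\<close>
  define r where "r = min \<delta> (m / (\<alpha> - 1))"
  have r: "0 < r" "r \<le> \<delta>"
    using \<delta>(1) m(1) \<alpha> by (auto simp: r_def)
  have "r \<le> m / (\<alpha> - 1)"
    by (simp add: r_def)
  then have r_le: "(\<alpha> - 1) * r \<le> m"
    using \<alpha> by (simp add: field_simps)
  obtain u where u: "dist x u \<le> r" "enlargement (G u) (\<alpha> * r) \<subseteq> enlargement (G x + C) r"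
    using \<delta>(2)[OF r] by auto
  have sum: "infdist s C \<le> m" if s: "s \<in> G x + C" for s
  proof -
    obtain g c where "s = g + c" "g \<in> G x" "c \<in> C"
      using s by (rule set_plus_elim)
    then show ?thesis
      using infdist_add_cone_le[OF C(1,2), of c g] m(2)[of g] by simp
  qed
  have "infdist y C \<le> m - (\<alpha> - 1) * r" if y: "y \<in> G u" for y
  proof (cases "infdist y C = 0")
    case True
    then show ?thesis
      using r_le by simp
  next
    case False
    then have pos: "0 < infdist y C"
      using infdist_nonneg[of y C] by linarith
    have "infdist z C \<le> m + r" if "dist y z \<le> \<alpha> * r" for z
    proof (rule infdist_le_add_of_enlargement[OF _ sum])
      have "z \<in> enlargement (G u) (\<alpha> * r)"
        using y that infdist_le2[of y "G u" z] by (auto simp: enlargement_def dist_commute)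
      then show "z \<in> enlargement (G x + C) r"
        using u by blast
    qed
    then have "infdist y C + \<alpha> * r \<le> m + r"
      using \<alpha> r by (intro infdist_add_radius_le[OF C(1,3) pos]) auto
    then show ?thesis
      by (simp add: algebra_simps)
  qed
  with r u that show thesis
    by blast
qed

text \<open>
  Ekeland's principle is applied to the excess of \<open>G\<close> over \<open>C\<close>.  An infeasible Ekeland point would
  contradict \<open>excess_decrease\<close>.
\<close>
lemma error_bound:
  fixes C :: "'y::real_normed_vector set" and G :: "'x::banach \<Rightarrow> 'y set"
  assumes C: "closed C" "convex C" "cone C" "C \<noteq> {}" and \<alpha>: "1 < \<alpha>"
    and G: "\<And>x. G x \<noteq> {}" "\<And>x. set_valued_lsc_at G x"
    and inc: "\<And>x. \<not> G x \<subseteq> C \<Longrightarrow> increases_with_constant C G x \<alpha>"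
    and m: "\<And>y. y \<in> G x0 \<Longrightarrow> infdist y C \<le> m"
  obtains x where "G x \<subseteq> C" and "(\<alpha> - 1) * dist x0 x \<le> m"
proof -
  \<comment> \<open>The excess may be infinite far from \<open>x0\<close>.  Truncation above its value at \<open>x0\<close> makes it real
    and does not change it where it is at most \<open>m\<close>.\<close>
  define f where "f x = (SUP y\<in>G x. min (m + 1) (infdist y C))" for x
  have bdd: "bdd_above ((\<lambda>y. min (m + 1) (infdist y C)) ` G x)" for x
    by (auto intro!: bdd_aboveI[of _ "m + 1"])
  have f_le_iff: "f x \<le> t \<longleftrightarrow> (\<forall>y\<in>G x. min (m + 1) (infdist y C) \<le> t)" for x t
    unfolding f_def using cSUP_le_iff[OF G(1) bdd] .
  have m_nonneg: "0 \<le> m"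
    using G(1)[of x0] m infdist_nonneg order_trans by blast
  have f_nonneg: "0 \<le> f x" for x
  proof -
    obtain y where "y \<in> G x"
      using G(1)[of x] by auto
    moreover have "0 \<le> min (m + 1) (infdist y C)"
      using m_nonneg infdist_nonneg[of y C] by simp
    ultimately show ?thesis
      unfolding f_def using bdd by (meson cSUP_upper order_trans)
  qed
  have lsc: "closed {x. f x \<le> t}" for t
  proof -
    define V where "V = {y. t < min (m + 1) (infdist y C)}"
    have "open V"
      unfolding V_def by (intro open_Collect_less continuous_intros)
    have "open {x. G x \<inter> V \<noteq> {}}"
      unfolding open_subopen[of "{x. G x \<inter> V \<noteq> {}}"]
    proof
      fix x assume "x \<in> {x. G x \<inter> V \<noteq> {}}"
      then have "\<forall>\<^sub>F x' in nhds x. G x' \<inter> V \<noteq> {}"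
        using G(2)[of x] \<open>open V\<close> by (auto simp: set_valued_lsc_at_def)
      then show "\<exists>T. open T \<and> x \<in> T \<and> T \<subseteq> {x. G x \<inter> V \<noteq> {}}"
        by (auto simp: eventually_nhds)
    qed
    moreover have "{x. f x \<le> t} = - {x. G x \<inter> V \<noteq> {}}"
      by (auto simp: f_le_iff V_def disjoint_iff min_le_iff_disj not_less)
    ultimately show ?thesis
      by (simp add: closed_def)
  qed
  have fx0: "f x0 \<le> m"
    using m by (force simp: f_le_iff min_def)
  obtain a where a: "f a + (\<alpha> - 1) * dist x0 a \<le> f x0"
    and a_min: "\<And>u. f u + (\<alpha> - 1) * dist a u \<le> f a \<Longrightarrow> u = a"
    using ekeland_principle[of f "\<alpha> - 1" x0] f_nonneg lsc \<alpha> by auto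
  have "0 \<le> (\<alpha> - 1) * dist x0 a"
    using \<alpha> by simp
  then have fa: "f a \<le> m"
    using a fx0 by linarith
  have excess_le: "infdist y C \<le> f a" if "y \<in> G a" for y
  proof -
    have "min (m + 1) (infdist y C) \<le> f a"
      using f_le_iff[of a "f a"] that by simp
    then show ?thesis
      using fa by (auto simp: min_def split: if_splits)
  qed
  have "G a \<subseteq> C"
  proof (rule ccontr)
    assume infeasible: "\<not> G a \<subseteq> C"
    then obtain y where y: "y \<in> G a" "y \<notin> C"
      by auto
    then have "0 < infdist y C"
      using C infdist_pos_not_in_closed by blast
    then have "0 < f a"
      using excess_le[OF y(1)] by linarith
    then obtain u r where u: "0 < r" "dist a u \<le> r"
      "\<And>y. y \<in> G u \<Longrightarrow> infdist y C \<le> f a - (\<alpha> - 1) * r"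
      using excess_decrease[OF C(2-4) \<alpha> inc[OF infeasible] _ excess_le] by metis
    then have fu: "f u \<le> f a - (\<alpha> - 1) * r"
      by (auto simp: f_le_iff min_le_iff_disj)
    moreover have "(\<alpha> - 1) * dist a u \<le> (\<alpha> - 1) * r"
      using \<alpha> u by (intro mult_left_mono) auto
    ultimately have "u = a"
      by (intro a_min) linarith
    moreover have "0 < (\<alpha> - 1) * r"
      using \<alpha> u by simp
    ultimately show False
      using fu by simp
  qed
  moreover have "(\<alpha> - 1) * dist x0 a \<le> m"
    using a fx0 f_nonneg[of a] by linarith
  ultimately show thesis
    by (rule that)
qed

lemma uniform_inc_bound_gt_oneD:
  assumes "1 < uniform_inc_bound C F"
  obtains \<alpha> where "1 < \<alpha>"
    and "\<And>p x. \<not> F (p, x) \<subseteq> C \<Longrightarrow> increases_with_constant C (\<lambda>x'. F (p, x')) x \<alpha>"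
proof -
  obtain \<alpha> where \<alpha>: "1 < ereal \<alpha>" "ereal \<alpha> < uniform_inc_bound C F"
    using ereal_dense2[OF assms] by auto
  show thesis
  proof (rule that)
    show "1 < \<alpha>"
      using \<alpha>(1) by (simp add: one_ereal_def)
    fix p x assume "\<not> F (p, x) \<subseteq> C"
    then have "uniform_inc_bound C F \<le> inc_bound C (\<lambda>x'. F (p, x')) x"
      unfolding uniform_inc_bound_def by (intro Inf_lower) blast
    then have "ereal \<alpha> < inc_bound C (\<lambda>x'. F (p, x')) x"
      using \<alpha>(2) by (rule less_le_trans[rotated])
    then obtain \<beta> where "\<alpha> < \<beta>" "increases_with_constant C (\<lambda>x'. F (p, x')) x \<beta>"
      by (auto simp: inc_bound_def less_Sup_iff)
    then show "increases_with_constant C (\<lambda>x'. F (p, x')) x \<alpha>"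
      using increases_with_constant_mono by fastforce
  qed
qed

section \<open>The feasible-set mapping\<close>

lemma cone_bounded_infdist_le:
  assumes "0 \<in> C" and "cone_bounded C S"
  obtains m where "\<And>y. y \<in> S \<Longrightarrow> infdist y C \<le> m"
proof -
  obtain b where b: "0 < b" "\<And>y. y \<in> S - C \<Longrightarrow> norm y \<le> b"
    using assms(2) unfolding cone_bounded_def bounded_pos by blast
  have "infdist y C \<le> b" if "y \<in> S" for y
  proof (cases "y \<in> C")
    case True
    then show ?thesis
      using b(1) by simp
  next
    case False
    then show ?thesis
      using infdist_le[OF assms(1), of y] b(2)[of y] that by simp
  qed
  with that show thesis
    by blast
qed

text \<open>
  Upper semicontinuity in the parameter makes the excess of \<open>F (q, x)\<close> over \<open>C\<close> small for \<open>q\<close> near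
  \<open>p\<close>, and the error bound turns a small excess into a nearby feasible point.
\<close>
lemma feasible_inner_semicontinuous:
  fixes C :: "'y::real_normed_vector set"
    and F :: "'p::real_normed_vector \<times> 'x::banach \<Rightarrow> 'y set"
  assumes C: "closed C" "convex C" "cone C" "C \<noteq> {}" and \<alpha>: "1 < \<alpha>"
    and F: "\<And>p x. F (p, x) \<noteq> {}" "\<And>p x. set_valued_lsc_at (\<lambda>x'. F (p, x')) x"
    and inc: "\<And>p x. \<not> F (p, x) \<subseteq> C \<Longrightarrow> increases_with_constant C (\<lambda>x'. F (p, x')) x \<alpha>"
    and usc: "hausdorff_cone_usc_at C (\<lambda>p'. F (p', x)) p"
    and x: "x \<in> feasible C F p" and \<epsilon>: "0 < \<epsilon>"
  obtains \<delta> where "0 < \<delta>" and "\<And>q. dist p q \<le> \<delta> \<Longrightarrow> \<exists>u\<in>feasible C F q. dist x u \<le> \<epsilon>"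
proof -
  have "0 < (\<alpha> - 1) * \<epsilon>"
    using \<alpha> \<epsilon> by simp
  then obtain \<delta> where \<delta>: "0 < \<delta>"
    "\<And>q. dist p q \<le> \<delta> \<Longrightarrow> F (q, x) \<subseteq> enlargement (F (p, x) + C) ((\<alpha> - 1) * \<epsilon>)"
    using usc by (auto simp: hausdorff_cone_usc_at_def)
  have "\<exists>u\<in>feasible C F q. dist x u \<le> \<epsilon>" if q: "dist p q \<le> \<delta>" for q
  proof -
    have "infdist s C \<le> 0" if s: "s \<in> F (p, x) + C" for s
    proof -
      obtain g c where "s = g + c" "g \<in> F (p, x)" "c \<in> C"
        using s by (rule set_plus_elim)
      then have "s \<in> C"
        using x convex_cone_add_closed[OF C(2,3)] by (auto simp: feasible_def)
      then show ?thesis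
        by simp
    qed
    then have "infdist y C \<le> (\<alpha> - 1) * \<epsilon>" if "y \<in> F (q, x)" for y
      using infdist_le_add_of_enlargement[of y "F (p, x) + C" _ C 0] \<delta>(2)[OF q] that by force
    then obtain u where u: "F (q, u) \<subseteq> C" "(\<alpha> - 1) * dist x u \<le> (\<alpha> - 1) * \<epsilon>"
      using error_bound[of C \<alpha> "\<lambda>x'. F (q, x')" x] C \<alpha> F inc by metis
    then show ?thesis
      using \<alpha> by (auto simp: feasible_def)
  qed
  with \<delta>(1) that show thesis
    by blast
qed

lemma feasible_convex_combination:
  assumes C: "convex C" "cone C" and conc: "cone_concave C F"
    and x: "x \<in> feasible C F p" and y: "y \<in> feasible C F q" and t: "0 \<le> t" "t \<le> 1"
  shows "(1 - t) *\<^sub>R x + t *\<^sub>R y \<in> feasible C F ((1 - t) *\<^sub>R p + t *\<^sub>R q)"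
proof -
  have "F ((1 - t) *\<^sub>R (p, x) + (1 - (1 - t)) *\<^sub>R (q, y))
      \<subseteq> (\<lambda>y. (1 - t) *\<^sub>R y) ` F (p, x) + (\<lambda>y. (1 - (1 - t)) *\<^sub>R y) ` F (q, y) + C"
    using conc t unfolding cone_concave_def by (meson atLeastAtMost_iff diff_ge_0_iff_ge diff_le_eq le_add_same_cancel1)
  also have "\<dots> \<subseteq> C"
  proof
    fix z assume "z \<in> (\<lambda>y. (1 - t) *\<^sub>R y) ` F (p, x) + (\<lambda>y. (1 - (1 - t)) *\<^sub>R y) ` F (q, y) + C"
    then obtain u v c where z: "z = (1 - t) *\<^sub>R u + t *\<^sub>R v + c" "u \<in> C" "v \<in> C" "c \<in> C"
      using x y by (auto elim!: set_plus_elim simp: feasible_def) blast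
    have "(1 - t) *\<^sub>R u + t *\<^sub>R v \<in> C"
      using C(1) z t by (intro convexD) auto
    then show "z \<in> C"
      using z convex_cone_add_closed[OF C] by blast
  qed
  finally show ?thesis
    by (simp add: feasible_def)
qed

section \<open>Convex extended-real functions\<close>

lemma val_less_iff: "val C F \<phi> p < ereal b \<longleftrightarrow> (\<exists>x\<in>feasible C F p. \<phi> (p, x) < b)"
  by (simp add: val_def INF_less_iff)

text \<open>
  Convexity of \<open>val\<close> is stated through its strict epigraph: the convex combination of extended
  reals would be undefined when one value is \<open>+\<infinity>\<close> and the other \<open>-\<infinity>\<close>.
\<close>
lemma val_convex:
  assumes C: "convex C" "cone C" and conc: "cone_concave C F" and \<phi>: "convex_on UNIV \<phi>"
    and a: "val C F \<phi> p < ereal a" and b: "val C F \<phi> q < ereal b" and t: "0 < t" "t < 1"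
  shows "val C F \<phi> ((1 - t) *\<^sub>R p + t *\<^sub>R q) < ereal ((1 - t) * a + t * b)"
proof -
  obtain x where x: "x \<in> feasible C F p" "\<phi> (p, x) < a"
    using a by (auto simp: val_less_iff)
  obtain y where y: "y \<in> feasible C F q" "\<phi> (q, y) < b"
    using b by (auto simp: val_less_iff)
  have "\<phi> ((1 - t) *\<^sub>R (p, x) + t *\<^sub>R (q, y)) \<le> (1 - t) * \<phi> (p, x) + t * \<phi> (q, y)"
    using convex_onD[OF \<phi>, of t "(p, x)" "(q, y)"] t by simp
  also have "\<dots> < (1 - t) * a + t * b"
    using x y t by (intro add_strict_mono mult_strict_left_mono) auto
  finally show ?thesis
    using feasible_convex_combination[OF C conc x(1) y(1), of t] t by (auto simp: val_less_iff)
qed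

text \<open>
  Reflection in \<open>p\<close> turns the upper bound into a two-sided bound \<open>K\<close>.  Extending the segment from
  \<open>x\<close> to \<open>y\<close> beyond \<open>y\<close> by the length \<open>r\<close> stays in the larger ball, and convexity along it bounds the
  slope from \<open>x\<close> to \<open>y\<close> by \<open>2 K / r\<close>.
\<close>
lemma convex_bounded_above_imp_lipschitz:
  fixes g :: "'a::real_normed_vector \<Rightarrow> real"
  assumes g: "convex_on UNIV g" and r: "0 < r" and M: "\<And>q. dist p q \<le> 2 * r \<Longrightarrow> g q \<le> M"
  obtains L where "L-lipschitz_on (cball p r) g"
proof -
  define K where "K = \<bar>M\<bar> + 2 * \<bar>g p\<bar>"
  have K: "\<bar>g q\<bar> \<le> K" if q: "dist p q \<le> 2 * r" for q
  proof -
    have "dist p (2 *\<^sub>R p - q) = dist p q"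
      by (simp add: dist_norm scaleR_2 norm_minus_commute)
    then have "g (2 *\<^sub>R p - q) \<le> M"
      using M q by simp
    moreover have "g ((1 - 1/2) *\<^sub>R q + (1/2) *\<^sub>R (2 *\<^sub>R p - q))
        \<le> (1 - 1/2) * g q + 1/2 * g (2 *\<^sub>R p - q)"
      by (rule convex_onD[OF g]) auto
    moreover have "(1 - 1/2) *\<^sub>R q + (1/2) *\<^sub>R (2 *\<^sub>R p - q) = p"
      by (simp add: algebra_simps)
    ultimately show ?thesis
      using M[OF q] by (simp add: K_def)
  qed
  have K_nonneg: "0 \<le> K"
    by (simp add: K_def)
  have slope: "g y - g x \<le> 2 * K / r * dist x y" if x: "dist p x \<le> r" and y: "dist p y \<le> r" for x y
  proof (cases "x = y")
    case False
    define d where "d = dist x y"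
    have d: "0 < d"
      using False by (simp add: d_def)
    define z where "z = y + (r / d) *\<^sub>R (y - x)"
    have "dist y z = r"
      using d r by (simp add: z_def dist_norm d_def norm_minus_commute)
    then have z: "dist p z \<le> 2 * r"
      using dist_triangle[of p z y] y by linarith
    define t where "t = d / (r + d)"
    have t: "0 \<le> t" "t \<le> 1" "t \<le> d / r"
      using d r by (auto simp: t_def field_simps)
    have "t + t * (r / d) = t * (r + d) / d"
      using d by (simp add: field_simps)
    then have t_eq: "t + t * (r / d) = 1"
      using d r by (simp add: t_def)
    have "(1 - t) *\<^sub>R x + t *\<^sub>R z = (1 - (t + t * (r / d))) *\<^sub>R x + (t + t * (r / d)) *\<^sub>R y"
      by (simp add: z_def algebra_simps)
    also have "\<dots> = y"
      by (simp only: t_eq) simp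
    finally have "g y \<le> (1 - t) * g x + t * g z"
      using convex_onD[OF g t(1,2), of x z] by simp
    then have "g y - g x \<le> t * (g z - g x)"
      by (simp add: algebra_simps)
    also have "\<dots> \<le> t * (2 * K)"
      using K[OF z] K[of x] x r t by (intro mult_left_mono) auto
    also have "\<dots> \<le> d / r * (2 * K)"
      using t K_nonneg by (intro mult_right_mono) auto
    finally show ?thesis
      by (simp add: d_def field_simps)
  qed simp
  have "(2 * K / r)-lipschitz_on (cball p r) g"
  proof (rule lipschitz_onI)
    fix x y assume "x \<in> cball p r" "y \<in> cball p r"
    then show "dist (g x) (g y) \<le> 2 * K / r * dist x y"
      using slope[of x y] slope[of y x] by (auto simp: dist_real_def dist_commute abs_le_iff)
  qed (use K_nonneg r in auto)
  then show thesis
    by (rule that)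
qed

text \<open>
  If \<open>f p0 = -\<infinity>\<close>, then any \<open>p\<close> is the midpoint of \<open>p0\<close> and a point where \<open>f < +\<infinity>\<close>, so
  \<open>f p = -\<infinity>\<close> by convexity.
\<close>
lemma convex_ereal_dichotomy:
  fixes f :: "'a::real_normed_vector \<Rightarrow> ereal"
  assumes conv: "\<And>p q a b t. f p < ereal a \<Longrightarrow> f q < ereal b \<Longrightarrow> 0 < t \<Longrightarrow> t < 1 \<Longrightarrow>
      f ((1 - t) *\<^sub>R p + t *\<^sub>R q) < ereal ((1 - t) * a + t * b)"
    and bdd: "\<And>p. \<exists>r>0. \<exists>M. \<forall>q. dist p q \<le> r \<longrightarrow> f q < ereal M"
  shows "(\<forall>p. f p = -\<infinity>) \<or> (finite_dom f = UNIV \<and> (\<forall>p. locally_lipschitz_around f p))"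
proof (cases "\<exists>p0. f p0 = -\<infinity>")
  case True
  then obtain p0 where p0: "f p0 = -\<infinity>" ..
  have "f p = -\<infinity>" for p
  proof (rule ereal_bot)
    fix B :: real
    obtain b where b: "f (2 *\<^sub>R p - p0) < ereal b"
      using bdd[of "2 *\<^sub>R p - p0"] by (metis dist_self less_imp_le)
    have "f p0 < ereal (2 * B - b)"
      using p0 by simp
    from conv[OF this b, of "1/2"]
    have "f ((1 - 1/2) *\<^sub>R p0 + (1/2) *\<^sub>R (2 *\<^sub>R p - p0)) < ereal B"
      by (simp add: field_simps)
    moreover have "(1 - 1/2) *\<^sub>R p0 + (1/2) *\<^sub>R (2 *\<^sub>R p - p0) = p"
      by (simp add: algebra_simps)
    ultimately show "f p \<le> ereal B"
      by simp
  qed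
  then show ?thesis
    by blast
next
  case False
  have finite: "\<bar>f p\<bar> \<noteq> \<infinity>" for p
  proof -
    obtain M where "f p < ereal M"
      using bdd[of p] by (metis dist_self less_imp_le)
    then show ?thesis
      using False by (cases "f p") auto
  qed
  define g where "g p = real_of_ereal (f p)" for p
  have f_eq: "f p = ereal (g p)" for p
    using finite[of p] by (simp add: g_def ereal_real)
  have "convex_on UNIV g"
  proof (rule convex_onI)
    fix t :: real and p q assume t: "0 < t" "t < 1"
    show "g ((1 - t) *\<^sub>R p + t *\<^sub>R q) \<le> (1 - t) * g p + t * g q"
    proof (rule field_le_epsilon)
      fix e :: real assume "0 < e"
      then have "g ((1 - t) *\<^sub>R p + t *\<^sub>R q) < (1 - t) * (g p + e) + t * (g q + e)"
        using conv[of p "g p + e" q "g q + e" t] t by (simp add: f_eq)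
      also have "\<dots> = (1 - t) * g p + t * g q + e"
        by (simp add: algebra_simps)
      finally show "g ((1 - t) *\<^sub>R p + t *\<^sub>R q) \<le> (1 - t) * g p + t * g q + e"
        by simp
    qed
  qed simp
  have "locally_lipschitz_around f p" for p
  proof -
    obtain r M where r: "0 < r" "\<And>q. dist p q \<le> r \<Longrightarrow> f q < ereal M"
      using bdd[of p] by blast
    then have "g q \<le> M" if "dist p q \<le> 2 * (r / 2)" for q
      using that by (simp add: f_eq less_imp_le)
    then obtain L where "L-lipschitz_on (cball p (r / 2)) g"
      using convex_bounded_above_imp_lipschitz[OF \<open>convex_on UNIV g\<close>, of "r / 2" p M] r(1) by auto
    then show ?thesis
      using r(1) finite unfolding locally_lipschitz_around_def g_def finite_dom_def
      by (intro exI[of _ "r / 2"]) auto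
  qed
  then show ?thesis
    using finite by (auto simp: finite_dom_def)
qed

section \<open>The value function\<close>

theorem theorem3p2:
  fixes C :: "'y::banach set"
    and \<phi> :: "'p::banach \<times> 'x::banach \<Rightarrow> real"
    and F :: "'p \<times> 'x \<Rightarrow> 'y set"
  assumes "closed C" and "convex C" and "cone C"
    and "{0} \<subset> C" and "C \<subset> UNIV"
    and "\<And>p x. F (p, x) \<noteq> {}" and "\<And>p x. closed (F (p, x))"
    and "convex_on UNIV \<phi>" and "continuous_on UNIV \<phi>"
    and "\<And>p. \<exists>x. cone_bounded C (F (p, x))"
    and "\<And>p x. set_valued_lsc_at (\<lambda>x'. F (p, x')) x"
    and "cone_concave C F"
    and "\<And>x p. hausdorff_cone_usc_at C (\<lambda>p'. F (p', x)) p"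
    and "uniform_inc_bound C F > 1"
  shows "(\<forall>p. val C F \<phi> p = -\<infinity>) \<or>
         (finite_dom (val C F \<phi>) = UNIV \<and>
          (\<forall>p. locally_lipschitz_around (val C F \<phi>) p))"
proof (rule convex_ereal_dichotomy)
  show "val C F \<phi> ((1 - t) *\<^sub>R p + t *\<^sub>R q) < ereal ((1 - t) * a + t * b)"
    if "val C F \<phi> p < ereal a" "val C F \<phi> q < ereal b" "0 < t" "t < 1" for p q a b t
    using val_convex[OF assms(2,3,12,8) that] .
next
  fix p
  have C0: "0 \<in> C" "C \<noteq> {}"
    using assms(4) by auto
  obtain \<alpha> where \<alpha>: "1 < \<alpha>"
    and inc: "\<And>p x. \<not> F (p, x) \<subseteq> C \<Longrightarrow> increases_with_constant C (\<lambda>x'. F (p, x')) x \<alpha>"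
    using uniform_inc_bound_gt_oneD[OF assms(14)] by metis
  obtain x0 where "cone_bounded C (F (p, x0))"
    using assms(10) by blast
  then obtain m where "\<And>y. y \<in> F (p, x0) \<Longrightarrow> infdist y C \<le> m"
    using cone_bounded_infdist_le[OF C0(1)] by metis
  then obtain x where x: "x \<in> feasible C F p"
    using error_bound[of C \<alpha> "\<lambda>x'. F (p, x')" x0 m] assms(1-3) C0(2) \<alpha> assms(6,11) inc
    unfolding feasible_def by (metis mem_Collect_eq)
  have "isCont \<phi> (p, x)"
    using assms(9) by (simp add: continuous_on_eq_continuous_at)
  then obtain \<eta> where \<eta>: "0 < \<eta>" "\<And>w. dist w (p, x) < \<eta> \<Longrightarrow> dist (\<phi> w) (\<phi> (p, x)) < 1"
    unfolding continuous_at_eps_delta using zero_less_one by blast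
  obtain \<delta> where \<delta>: "0 < \<delta>" "\<And>q. dist p q \<le> \<delta> \<Longrightarrow> \<exists>u\<in>feasible C F q. dist x u \<le> \<eta> / 3"
    using feasible_inner_semicontinuous[OF assms(1-3) C0(2) \<alpha> assms(6,11) inc assms(13) x, of "\<eta> / 3"]
      \<eta>(1) by auto
  have "val C F \<phi> q < ereal (\<phi> (p, x) + 1)" if q: "dist p q \<le> min \<delta> (\<eta> / 3)" for q
  proof -
    obtain u where u: "u \<in> feasible C F q" "dist x u \<le> \<eta> / 3"
      using \<delta>(2) q by auto
    have "dist (q, u) (p, x) \<le> dist q p + dist u x"
      by (simp add: dist_Pair_Pair sqrt_sum_squares_le_sum)
    also have "\<dots> < \<eta>"
      using q u \<eta>(1) by (simp add: dist_commute)
    finally have "\<phi> (q, u) < \<phi> (p, x) + 1"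
      using \<eta>(2)[of "(q, u)"] by (simp add: dist_real_def abs_less_iff)
    with u show ?thesis
      by (auto simp: val_less_iff)
  qed
  then show "\<exists>r>0. \<exists>M. \<forall>q. dist p q \<le> r \<longrightarrow> val C F \<phi> q < ereal M"
    using \<delta>(1) \<eta>(1) by (intro exI[of _ "min \<delta> (\<eta> / 3)"]) auto
qed

end
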